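(* Let $(\mathcal{N},P_S)$ be the $Z_0/Z_1$ channel and $(\mathcal{N}^{\mathrm{CSIR}},P_S)$ its associated channel with CSIR. Then $$\eta^{\mathrm{NS},\mathrm{ca}}_{\mathrm{opt},M=2,n=2}(\mathcal{N}^{\mathrm{CSIR}},P_S)\ \ge\ \eta^{\mathrm{C},\mathrm{ca}}_{\mathrm{opt},M=2,n=2}(\mathcal{N}^{\mathrm{CSIR}},P_S)\ \ge\ \tfrac78,$$ and $$\eta^{\mathrm{NS},\mathrm{ca}}_{\mathrm{opt},M=2,n=2}(\mathcal{N},P_S)\ \le\ \tfrac{13}{16}.$$
   Context: A channel with state $(\mathcal{N},P_S)$ consists of finite sets $\mathcal{X},\mathcal{Y},\mathcal{S}$, a conditional distribution $\mathcal{N}(y\mid x,s)$ and a state distribution $P_S$; over $n$ uses, $P_S^{\otimes n}(s^n)=\prod_i P_S(s_i)$ and $\mathcal{N}^{\otimes n}(y^n\mid x^n,s^n)=\prod_i\mathcal{N}(y_i\mid x_i,s_i)$. Notation: $x^i=(x_1,\dots,x_i)$, $x_{i+1}^n=(x_{i+1},\dots,x_n)$, $[M]=\{1,\dots,M\}$. The $Z_0/Z_1$ channel: $\mathcal{X}=\mathcal{Y}=\mathcal{S}=\{0,1\}$, $P_S(0)=P_S(1)=1/2$, $\mathcal{N}(0\mid0,0)=1$, $\mathcal{N}(1\mid0,0)=0$, $\mathcal{N}(0\mid1,0)=\mathcal{N}(1\mid1,0)=1/2$, $\mathcal{N}(1\mid1,1)=1$, $\mathcal{N}(0\mid1,1)=0$,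 $\mathcal{N}(0\mid0,1)=\mathcal{N}(1\mid0,1)=1/2$. The associated channel with CSIR $(\mathcal{N}^{\mathrm{CSIR}},P_S)$ is the channel with state having the same input and state alphabets, output alphabet $\mathcal{Y}\times\mathcal{S}$, the same $P_S$, and $\mathcal{N}^{\mathrm{CSIR}}((y,s^R)\mid x,s)=\mathcal{N}(y\mid x,s)\,\mathbb{I}[s^R=s]$. A classical coding scheme with causal CSIT with message size $M$ and blocklength $n$ consists of a shared random variable $Q$ on a finite set with distribution $P_Q$, an encoder $E(x^n\mid w,s^n,q)=\prod_{j=1}^n E(x_j\mid x^{j-1},w,s^j,q)$, and a decoder $D(\hat w\mid y^n,q)$; its success probability is $\eta=\frac1M\sum_w\sum_q P_Q(q)\sum_{x^n,s^n,y^n}P_S^{\otimes n}(s^n)E(x^n\mid w,s^n,q)\mathcal{N}^{\otimes n}(y^n\mid x^n,s^n)D(w\mid y^n,q)$ (with $\mathcal{N}$ replaced by the channel under consideration). An NS-assisted coding scheme with causal CSIT with message size $M$ and blocklength $n$ is a conditional distribution $Z(x^n,\hat w\mid w,s^n,y^n)$ on $\mathcal{X}^n\times[M]$ given $(w,s^n,y^n)\in[M]\times\mathcal{S}^n\times\mathcal{Y}^n$ such that: (C1) $\sum_{\hat w}Z(x^n,\hat w\mid w,s^n,y^n)$ does not depend on $y^n$; (C2) $\sum_{x^n}Z(x^n,\hat w\mid w,s^n,y^n)$ does not depend on $(w,s^n)$; (C3) for each $i\in[n-1]$, $\sum_{x_{i+1}^n}Z(x^n,\hat w\mid w,s^n,y^n)$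 does not depend on $s_{i+1}^n$. (For the CSIR channel, $\mathcal{Y}$ is replaced by $\mathcal{Y}\times\mathcal{S}$.) Its success probability is $\eta(Z)=\frac1M\sum_{w}\sum_{x^n,s^n,y^n}P_S^{\otimes n}(s^n)\mathcal{N}^{\otimes n}(y^n\mid x^n,s^n)Z(x^n,w\mid w,s^n,y^n)$. $\eta^{\mathrm{C},\mathrm{ca}}_{\mathrm{opt},M,n}$ and $\eta^{\mathrm{NS},\mathrm{ca}}_{\mathrm{opt},M,n}$ denote the suprema of the success probability over all classical, respectively NS-assisted, coding schemes with causal CSIT with message size $M$ and blocklength $n$ for the indicated channel. *)

theory Defs
  imports Complex_Main
begin

text \<open>Conventions. A channel with state is given by finite types 'x (inputs), 's (states),
 'y (outputs), a function N with N x s y = N(y | x, s), and a state distribution PS.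
 Sequences of length n are lists of length n; x^i = take i xs.
 Messages are [M] = {1..M}. The shared randomness Q ranges over a finite set of naturals
 (every finite set embeds into nat).\<close>

definition seqs :: "nat \<Rightarrow> 'a list set" where
  "seqs n = {xs. length xs = n}"

definition msgs :: "nat \<Rightarrow> nat set" where
  "msgs M = {1..M}"

definition PSn :: "('s \<Rightarrow> real) \<Rightarrow> 's list \<Rightarrow> real" where
  "PSn PS ss = (\<Prod>i<length ss. PS (ss ! i))"

definition Nn :: "('x \<Rightarrow> 's \<Rightarrow> 'y \<Rightarrow> real) \<Rightarrow> 'x list \<Rightarrow> 's list \<Rightarrow> 'y list \<Rightarrow> real" where
  "Nn N xs ss ys = (\<Prod>i<length xs. N (xs ! i) (ss ! i) (ys ! i))"

definition csir :: "('x \<Rightarrow> 's \<Rightarrow> 'y \<Rightarrow> real) \<Rightarrow> 'x \<Rightarrow> 's \<Rightarrow> ('y \<times> 's) \<Rightarrow> real" where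
  "csir N x s ysr = N x s (fst ysr) * (if snd ysr = s then 1 else 0)"

text \<open>The Z0/Z1 channel (0 = False, 1 = True), N x s y = N(y|x,s).\<close>
definition zchan :: "bool \<Rightarrow> bool \<Rightarrow> bool \<Rightarrow> real" where
  "zchan x s y = (if x = s then (if y = x then 1 else 0) else 1/2)"

definition zPS :: "bool \<Rightarrow> real" where
  "zPS s = 1/2"

text \<open>Encoder E j xprev w sj q x = E(x_j = x | x^{j-1} = xprev, w, s^j = sj, q), j \<in> {1..n}.
 Decoder D ys q w' = D(w' | y^n = ys, q).\<close>

definition enc_prod ::
  "(nat \<Rightarrow> 'x list \<Rightarrow> nat \<Rightarrow> 's list \<Rightarrow> nat \<Rightarrow> 'x \<Rightarrow> real) \<Rightarrow> nat \<Rightarrow> 'x list \<Rightarrow> nat \<Rightarrow> 's list \<Rightarrow> nat \<Rightarrow> real" where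
  "enc_prod E n xs w ss q = (\<Prod>j\<in>{1..n}. E j (take (j - 1) xs) w (take j ss) q (xs ! (j - 1)))"

definition classical_scheme ::
  "nat \<Rightarrow> nat \<Rightarrow> nat set \<Rightarrow> (nat \<Rightarrow> real)
   \<Rightarrow> (nat \<Rightarrow> 'x::finite list \<Rightarrow> nat \<Rightarrow> 's::finite list \<Rightarrow> nat \<Rightarrow> 'x \<Rightarrow> real)
   \<Rightarrow> ('y::finite list \<Rightarrow> nat \<Rightarrow> nat \<Rightarrow> real) \<Rightarrow> bool" where
  "classical_scheme M n Qs PQ E D \<longleftrightarrow>
     finite Qs \<and> (\<forall>q\<in>Qs. PQ q \<ge> 0) \<and> (\<Sum>q\<in>Qs. PQ q) = 1 \<and>
     (\<forall>j\<in>{1..n}. \<forall>xp\<in>seqs (j - 1). \<forall>w\<in>msgs M. \<forall>sj\<in>seqs j. \<forall>q\<in>Qs.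
        (\<forall>x. E j xp w sj q x \<ge> 0) \<and> (\<Sum>x\<in>UNIV. E j xp w sj q x) = 1) \<and>
     (\<forall>ys\<in>seqs n. \<forall>q\<in>Qs.
        (\<forall>w'\<in>msgs M. D ys q w' \<ge> 0) \<and> (\<Sum>w'\<in>msgs M. D ys q w') = 1)"

definition classical_success ::
  "('x::finite \<Rightarrow> 's::finite \<Rightarrow> 'y::finite \<Rightarrow> real) \<Rightarrow> ('s \<Rightarrow> real) \<Rightarrow> nat \<Rightarrow> nat
   \<Rightarrow> nat set \<Rightarrow> (nat \<Rightarrow> real)
   \<Rightarrow> (nat \<Rightarrow> 'x list \<Rightarrow> nat \<Rightarrow> 's list \<Rightarrow> nat \<Rightarrow> 'x \<Rightarrow> real)
   \<Rightarrow> ('y list \<Rightarrow> nat \<Rightarrow> nat \<Rightarrow> real) \<Rightarrow> real" where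
  "classical_success N PS M n Qs PQ E D =
     (1 / real M) * (\<Sum>w\<in>msgs M. \<Sum>q\<in>Qs. PQ q *
        (\<Sum>xs\<in>seqs n. \<Sum>ss\<in>seqs n. \<Sum>ys\<in>seqs n.
           PSn PS ss * enc_prod E n xs w ss q * Nn N xs ss ys * D ys q w))"

definition eta_C_ca ::
  "('x::finite \<Rightarrow> 's::finite \<Rightarrow> 'y::finite \<Rightarrow> real) \<Rightarrow> ('s \<Rightarrow> real) \<Rightarrow> nat \<Rightarrow> nat \<Rightarrow> real" where
  "eta_C_ca N PS M n =
     Sup {classical_success N PS M n Qs PQ E D | Qs PQ E D. classical_scheme M n Qs PQ E D}"

text \<open>Z xs w' w ss ys = Z(x^n = xs, w' | w, s^n = ss, y^n = ys).\<close>

definition ns_scheme ::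
  "nat \<Rightarrow> nat \<Rightarrow> ('x::finite list \<Rightarrow> nat \<Rightarrow> nat \<Rightarrow> 's::finite list \<Rightarrow> 'y::finite list \<Rightarrow> real) \<Rightarrow> bool" where
  "ns_scheme M n Z \<longleftrightarrow>
     (\<forall>w\<in>msgs M. \<forall>ss\<in>seqs n. \<forall>ys\<in>seqs n.
        (\<forall>xs\<in>seqs n. \<forall>w'\<in>msgs M. Z xs w' w ss ys \<ge> 0) \<and>
        (\<Sum>xs\<in>seqs n. \<Sum>w'\<in>msgs M. Z xs w' w ss ys) = 1) \<and>
     \<comment> \<open>(C1)\<close>
     (\<forall>xs\<in>seqs n. \<forall>w\<in>msgs M. \<forall>ss\<in>seqs n. \<forall>ys\<in>seqs n. \<forall>ys'\<in>seqs n.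
        (\<Sum>w'\<in>msgs M. Z xs w' w ss ys) = (\<Sum>w'\<in>msgs M. Z xs w' w ss ys')) \<and>
     \<comment> \<open>(C2)\<close>
     (\<forall>w'\<in>msgs M. \<forall>ys\<in>seqs n. \<forall>w1\<in>msgs M. \<forall>w2\<in>msgs M. \<forall>ss1\<in>seqs n. \<forall>ss2\<in>seqs n.
        (\<Sum>xs\<in>seqs n. Z xs w' w1 ss1 ys) = (\<Sum>xs\<in>seqs n. Z xs w' w2 ss2 ys)) \<and>
     \<comment> \<open>(C3)\<close>
     (\<forall>i\<in>{1..n-1}. \<forall>xs\<in>seqs n. \<forall>w'\<in>msgs M. \<forall>w\<in>msgs M. \<forall>ys\<in>seqs n.
        \<forall>ss1\<in>seqs n. \<forall>ss2\<in>seqs n. take i ss1 = take i ss2 \<longrightarrow>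
          (\<Sum>xs'\<in>{xs'\<in>seqs n. take i xs' = take i xs}. Z xs' w' w ss1 ys) =
          (\<Sum>xs'\<in>{xs'\<in>seqs n. take i xs' = take i xs}. Z xs' w' w ss2 ys))"

definition ns_success ::
  "('x::finite \<Rightarrow> 's::finite \<Rightarrow> 'y::finite \<Rightarrow> real) \<Rightarrow> ('s \<Rightarrow> real) \<Rightarrow> nat \<Rightarrow> nat
   \<Rightarrow> ('x list \<Rightarrow> nat \<Rightarrow> nat \<Rightarrow> 's list \<Rightarrow> 'y list \<Rightarrow> real) \<Rightarrow> real" where
  "ns_success N PS M n Z =
     (1 / real M) * (\<Sum>w\<in>msgs M. \<Sum>xs\<in>seqs n. \<Sum>ss\<in>seqs n. \<Sum>ys\<in>seqs n.
        PSn PS ss * Nn N xs ss ys * Z xs w w ss ys)"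

definition eta_NS_ca ::
  "('x::finite \<Rightarrow> 's::finite \<Rightarrow> 'y::finite \<Rightarrow> real) \<Rightarrow> ('s \<Rightarrow> real) \<Rightarrow> nat \<Rightarrow> nat \<Rightarrow> real" where
  "eta_NS_ca N PS M n = Sup {ns_success N PS M n Z | Z. ns_scheme M n Z}"

end

theory Submission
  imports Defs
begin

text \<open>The substitution \<open>u = x \<oplus> s\<close>, \<open>v = y \<oplus> s\<close> turns the \<open>Z\<^sub>0/Z\<^sub>1\<close> channel into the
  Z-channel \<open>u \<mapsto> v\<close> in either state.  With CSIR the receiver can compute \<open>v\<close>, so repetition
  coding succeeds with probability \<open>(1 + 3/4)/2 = 7/8\<close>.  Without CSIR, averaging an NS-assisted
  scheme over the states with \<open>u\<close> and \<open>v\<close> held fixed leaves a linear program over the averages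
  \<open>r(u\<^sub>1,u\<^sub>2|v\<^sub>1,v\<^sub>2)\<close>.  Flipping \<open>s\<^sub>2\<close> for fixed \<open>y\<^sub>2\<close> flips \<open>v\<^sub>2\<close>, so by causality
  \<open>\<Sum>u\<^sub>2. r(u\<^sub>1,u\<^sub>2|v\<^sub>1,v\<^sub>2)\<close> is independent of \<open>v\<^sub>2\<close>; under this extra constraint a dual
  solution gives the bound \<open>13/16\<close>.\<close>

section \<open>Classical schemes are NS-assisted schemes\<close>

lemma finite_seqs [simp]: "finite (seqs n :: 'a::finite list set)"
  using finite_lists_length_eq[of "UNIV :: 'a set" n] by (simp add: seqs_def)

lemma enc_prod_snoc:
  assumes "length xs = n"
  shows "enc_prod E (Suc n) (xs @ [x]) w ss q =
    enc_prod E n xs w ss q * E (Suc n) xs w (take (Suc n) ss) q x"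
proof -
  have "(\<Prod>j=1..n. E j (take (j - 1) (xs @ [x])) w (take j ss) q ((xs @ [x]) ! (j - 1))) =
        (\<Prod>j=1..n. E j (take (j - 1) xs) w (take j ss) q (xs ! (j - 1)))"
    using assms by (intro prod.cong) (auto simp: nth_append)
  then show ?thesis
    using assms by (auto simp: enc_prod_def prod.nat_ivl_Suc' nth_append)
qed

text \<open>Appending is a bijection from pairs of a shorter sequence and a letter;
  \<open>i \<le> n\<close> keeps the prefix condition away from the appended letter.\<close>

lemma sum_seqs_Suc_prefix:
  fixes f :: "'a::finite list \<Rightarrow> real"
  assumes "i \<le> n"
  shows "(\<Sum>xs\<in>{xs \<in> seqs (Suc n). take i xs = p}. f xs) =
    (\<Sum>xs\<in>{xs \<in> seqs n. take i xs = p}. \<Sum>x\<in>UNIV. f (xs @ [x]))"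
proof -
  have img: "{xs \<in> seqs (Suc n). take i xs = p} =
      (\<lambda>(xs, x). xs @ [x]) ` ({xs \<in> seqs n. take i xs = p} \<times> UNIV)" (is "?L = ?R")
  proof (intro equalityI subsetI)
    fix ys assume "ys \<in> ?L"
    moreover from this have "ys = butlast ys @ [last ys]"
      by (cases ys rule: rev_cases) (auto simp: seqs_def)
    ultimately show "ys \<in> ?R"
      using assms by (intro image_eqI[of _ _ "(butlast ys, last ys)"])
        (auto simp: seqs_def take_butlast)
  qed (use assms in \<open>auto simp: seqs_def\<close>)
  have "inj_on (\<lambda>(xs, x). xs @ [x]) ({xs \<in> seqs n. take i xs = p} \<times> (UNIV :: 'a set))"
    by (auto simp: inj_on_def)
  then show ?thesis
    by (simp add: img sum.reindex sum.cartesian_product case_prod_unfold)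
qed

text \<open>The letters after position \<open>i\<close> are summed out starting with the last: only
  the last factor contains the last letter, and that factor is normalised. The case
  \<open>i = 0\<close> serves (C2), the other cases (C3).\<close>

lemma sum_enc_prod_prefix:
  fixes E :: "nat \<Rightarrow> 'x::finite list \<Rightarrow> nat \<Rightarrow> 's list \<Rightarrow> nat \<Rightarrow> 'x \<Rightarrow> real"
  assumes "i \<le> n" and "p \<in> seqs i" and "n \<le> length ss"
    and norm: "\<And>j xs. j \<in> {i<..n} \<Longrightarrow> xs \<in> seqs (j - 1) \<Longrightarrow> (\<Sum>x\<in>UNIV. E j xs w (take j ss) q x) = 1"
  shows "(\<Sum>xs\<in>{xs \<in> seqs n. take i xs = p}. enc_prod E n xs w ss q) = enc_prod E i p w ss q"
  using assms(1,3) norm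
proof (induction n rule: dec_induct)
  case base
  have "{xs \<in> seqs i. take i xs = p} = {p}"
    using \<open>p \<in> seqs i\<close> by (auto simp: seqs_def)
  then show ?case by simp
next
  case (step n)
  have "(\<Sum>xs\<in>{xs \<in> seqs (Suc n). take i xs = p}. enc_prod E (Suc n) xs w ss q) =
      (\<Sum>xs\<in>{xs \<in> seqs n. take i xs = p}. enc_prod E n xs w ss q *
        (\<Sum>x\<in>UNIV. E (Suc n) xs w (take (Suc n) ss) q x))"
    unfolding sum_seqs_Suc_prefix[OF step.hyps(1)] sum_distrib_left
    by (intro sum.cong refl enc_prod_snoc) (auto simp: seqs_def)
  also have "\<dots> = (\<Sum>xs\<in>{xs \<in> seqs n. take i xs = p}. enc_prod E n xs w ss q)"
    using step.hyps step.prems(2)[of "Suc n"] by (intro sum.cong) auto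
  also have "\<dots> = enc_prod E i p w ss q"
    using step.prems by (intro step.IH) auto
  finally show ?case .
qed

text \<open>Causality of the encoder: factor \<open>j\<close> sees only \<open>take j ss\<close>
  with \<open>j \<le> n\<close>. Together with the prefix sums this gives (C3).\<close>

lemma enc_prod_take_cong:
  assumes "take n ss = take n ss'"
  shows "enc_prod E n xs w ss q = enc_prod E n xs w ss' q"
  unfolding enc_prod_def
proof (intro prod.cong refl)
  fix j assume "j \<in> {1..n}"
  then have "take j ss = take j ss'"
    using arg_cong[OF assms, of "take j"] by (simp add: min_absorb1)
  then show "E j (take (j - 1) xs) w (take j ss) q (xs ! (j - 1)) =
      E j (take (j - 1) xs) w (take j ss') q (xs ! (j - 1))" by simp
qed

text \<open>What remains of a classical scheme once its shared randomness is averaged out; given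
  \<open>q\<close>, encoder and decoder act independently.\<close>

definition classical_to_ns where
  "classical_to_ns n Qs PQ E D xs w' w ss ys =
    (\<Sum>q\<in>Qs. PQ q * enc_prod E n xs w ss q * (D ys q w' :: real))"

lemma ns_scheme_classical_to_ns:
  fixes E :: "nat \<Rightarrow> 'x::finite list \<Rightarrow> nat \<Rightarrow> 's::finite list \<Rightarrow> nat \<Rightarrow> 'x \<Rightarrow> real"
    and D :: "'y::finite list \<Rightarrow> nat \<Rightarrow> nat \<Rightarrow> real"
  assumes "classical_scheme M n Qs PQ E D"
  shows "ns_scheme M n (classical_to_ns n Qs PQ E D)"
proof -
  let ?Z = "classical_to_ns n Qs PQ E D"
  have PQ: "\<And>q. q \<in> Qs \<Longrightarrow> PQ q \<ge> 0" "(\<Sum>q\<in>Qs. PQ q) = 1"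
    and E: "\<And>j xp w sj q x. \<lbrakk>j \<in> {1..n}; xp \<in> seqs (j - 1); w \<in> msgs M; sj \<in> seqs j; q \<in> Qs\<rbrakk> \<Longrightarrow>
      E j xp w sj q x \<ge> 0"
      "\<And>j xp w sj q. \<lbrakk>j \<in> {1..n}; xp \<in> seqs (j - 1); w \<in> msgs M; sj \<in> seqs j; q \<in> Qs\<rbrakk> \<Longrightarrow>
      (\<Sum>x\<in>UNIV. E j xp w sj q x) = 1"
    and D: "\<And>ys q w'. \<lbrakk>ys \<in> seqs n; q \<in> Qs; w' \<in> msgs M\<rbrakk> \<Longrightarrow> D ys q w' \<ge> 0"
      "\<And>ys q. \<lbrakk>ys \<in> seqs n; q \<in> Qs\<rbrakk> \<Longrightarrow> (\<Sum>w'\<in>msgs M. D ys q w') = 1"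
    using assms unfolding classical_scheme_def by blast+
  have take_seqs: "take j ss \<in> seqs j" if "ss \<in> seqs n" "j \<le> n" for j and ss :: "'c list"
    using that by (auto simp: seqs_def)
  have prefix: "(\<Sum>xs'\<in>{xs' \<in> seqs n. take i xs' = p}. ?Z xs' w' w ss ys) =
      (\<Sum>q\<in>Qs. PQ q * enc_prod E i p w ss q * D ys q w')"
    if "i \<le> n" "p \<in> seqs i" "w \<in> msgs M" "ss \<in> seqs n" for i p w' w ss ys
  proof -
    have "(\<Sum>xs'\<in>{xs' \<in> seqs n. take i xs' = p}. ?Z xs' w' w ss ys) =
        (\<Sum>q\<in>Qs. PQ q * (\<Sum>xs'\<in>{xs' \<in> seqs n. take i xs' = p}. enc_prod E n xs' w ss q) * D ys q w')"
      unfolding classical_to_ns_def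
      by (subst sum.swap) (simp add: sum_distrib_left sum_distrib_right)
    also have "\<dots> = (\<Sum>q\<in>Qs. PQ q * enc_prod E i p w ss q * D ys q w')"
    proof (intro sum.cong refl)
      fix q assume "q \<in> Qs"
      have "(\<Sum>xs'\<in>{xs' \<in> seqs n. take i xs' = p}. enc_prod E n xs' w ss q) = enc_prod E i p w ss q"
        using that \<open>q \<in> Qs\<close> take_seqs[of ss]
        by (intro sum_enc_prod_prefix E) (auto simp: seqs_def)
      then show "PQ q * (\<Sum>xs'\<in>{xs' \<in> seqs n. take i xs' = p}. enc_prod E n xs' w ss q) * D ys q w' =
          PQ q * enc_prod E i p w ss q * D ys q w'" by simp
    qed
    finally show ?thesis .
  qed
  \<comment> \<open>The empty prefix constrains nothing and its encoder product is 1. Neither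
    \<open>w\<close> nor \<open>ss\<close> survives on the right, which is (C2).\<close>
  have full: "(\<Sum>xs\<in>seqs n. ?Z xs w' w ss ys) = (\<Sum>q\<in>Qs. PQ q * D ys q w')"
    if "w \<in> msgs M" "ss \<in> seqs n" for w' w ss ys
    using prefix[of 0 "[]" w ss w' ys] that by (simp add: seqs_def enc_prod_def)
  \<comment> \<open>Normalisation of the decoder removes \<open>ys\<close>, which is (C1).\<close>
  have out: "(\<Sum>w'\<in>msgs M. ?Z xs w' w ss ys) = (\<Sum>q\<in>Qs. PQ q * enc_prod E n xs w ss q)"
    if "ys \<in> seqs n" for xs w ss ys
    unfolding classical_to_ns_def using that D(2)
    by (subst sum.swap) (simp flip: sum_distrib_left)
  have nonneg: "?Z xs w' w ss ys \<ge> 0"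
    if "xs \<in> seqs n" "w \<in> msgs M" "w' \<in> msgs M" "ss \<in> seqs n" "ys \<in> seqs n" for xs w w' ss ys
    unfolding classical_to_ns_def enc_prod_def using that
    by (intro sum_nonneg mult_nonneg_nonneg prod_nonneg ballI PQ D E) (auto simp: seqs_def)
  have total: "(\<Sum>xs\<in>seqs n. \<Sum>w'\<in>msgs M. ?Z xs w' w ss ys) = 1"
    if "w \<in> msgs M" "ss \<in> seqs n" "ys \<in> seqs n" for w ss ys
  proof -
    have "(\<Sum>xs\<in>seqs n. \<Sum>w'\<in>msgs M. ?Z xs w' w ss ys) = (\<Sum>w'\<in>msgs M. \<Sum>q\<in>Qs. PQ q * D ys q w')"
      using that by (subst sum.swap) (simp add: full)
    also have "\<dots> = (\<Sum>q\<in>Qs. PQ q * (\<Sum>w'\<in>msgs M. D ys q w'))"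
      by (subst sum.swap) (simp add: sum_distrib_left)
    also have "\<dots> = 1"
      using that by (simp add: D(2) PQ(2))
    finally show ?thesis .
  qed
  have causal: "(\<Sum>xs'\<in>{xs' \<in> seqs n. take i xs' = take i xs}. ?Z xs' w' w ss1 ys) =
      (\<Sum>xs'\<in>{xs' \<in> seqs n. take i xs' = take i xs}. ?Z xs' w' w ss2 ys)"
    if "i \<in> {1..n-1}" "xs \<in> seqs n" "w \<in> msgs M" "ss1 \<in> seqs n" "ss2 \<in> seqs n"
      "take i ss1 = take i ss2" for i xs w' w ss1 ss2 ys
  proof -
    have "i \<le> n" "take i xs \<in> seqs i"
      using that take_seqs[of xs i] by auto
    then show ?thesis
      using that by (simp add: prefix enc_prod_take_cong[of i ss1 ss2])
  qed
  show ?thesis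
    unfolding ns_scheme_def
    by (intro conjI ballI impI;
        (rule nonneg total causal; assumption | simp only: out | simp only: full))
qed

lemma ns_success_classical_to_ns:
  "ns_success N PS M n (classical_to_ns n Qs PQ E D) = classical_success N PS M n Qs PQ E D"
proof -
  have "(\<Sum>xs\<in>seqs n. \<Sum>ss\<in>seqs n. \<Sum>ys\<in>seqs n.
        PSn PS ss * Nn N xs ss ys * classical_to_ns n Qs PQ E D xs w w ss ys) =
      (\<Sum>q\<in>Qs. PQ q * (\<Sum>xs\<in>seqs n. \<Sum>ss\<in>seqs n. \<Sum>ys\<in>seqs n.
        PSn PS ss * enc_prod E n xs w ss q * Nn N xs ss ys * D ys q w))" for w
    unfolding classical_to_ns_def sum_distrib_left
    \<comment> \<open>With the inner index set fixed as \<open>Qs\<close>, the rewriting only moves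
      the sum over the shared randomness outward.\<close>
    by (simp only: sum.swap[where B = Qs]) (intro sum.cong refl, simp add: mult_ac)
  then show ?thesis
    by (simp add: ns_success_def classical_success_def)
qed

section \<open>Boundedness of NS success probabilities and comparison of the suprema\<close>

lemma ns_schemeD:
  assumes "ns_scheme M n Z" "w \<in> msgs M" "ss \<in> seqs n" "ys \<in> seqs n"
  shows ns_nonneg: "xs \<in> seqs n \<Longrightarrow> w' \<in> msgs M \<Longrightarrow> Z xs w' w ss ys \<ge> 0"
    and ns_sum: "(\<Sum>xs\<in>seqs n. \<Sum>w'\<in>msgs M. Z xs w' w ss ys) = 1"
    and ns_C1: "xs \<in> seqs n \<Longrightarrow> ys' \<in> seqs n \<Longrightarrow>
      (\<Sum>w'\<in>msgs M. Z xs w' w ss ys) = (\<Sum>w'\<in>msgs M. Z xs w' w ss ys')"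
    and ns_C2: "w' \<in> msgs M \<Longrightarrow> v \<in> msgs M \<Longrightarrow> ss' \<in> seqs n \<Longrightarrow>
      (\<Sum>xs\<in>seqs n. Z xs w' w ss ys) = (\<Sum>xs\<in>seqs n. Z xs w' v ss' ys)"
    and ns_C3: "i \<in> {1..n-1} \<Longrightarrow> xs \<in> seqs n \<Longrightarrow> w' \<in> msgs M \<Longrightarrow> ss' \<in> seqs n \<Longrightarrow>
      take i ss = take i ss' \<Longrightarrow>
      (\<Sum>xs'\<in>{xs'\<in>seqs n. take i xs' = take i xs}. Z xs' w' w ss ys) =
      (\<Sum>xs'\<in>{xs'\<in>seqs n. take i xs' = take i xs}. Z xs' w' w ss' ys)"
proof -
  show "xs \<in> seqs n \<Longrightarrow> w' \<in> msgs M \<Longrightarrow> Z xs w' w ss ys \<ge> 0"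
    and "(\<Sum>xs\<in>seqs n. \<Sum>w'\<in>msgs M. Z xs w' w ss ys) = 1"
    using assms(1)[unfolded ns_scheme_def, THEN conjunct1, THEN bspec, OF assms(2), THEN bspec,
        OF assms(3), THEN bspec, OF assms(4)] by blast+
  note conj = assms(1)[unfolded ns_scheme_def, THEN conjunct2]
  show "xs \<in> seqs n \<Longrightarrow> ys' \<in> seqs n \<Longrightarrow>
      (\<Sum>w'\<in>msgs M. Z xs w' w ss ys) = (\<Sum>w'\<in>msgs M. Z xs w' w ss ys')"
    using conj[THEN conjunct1] assms by blast
  show "w' \<in> msgs M \<Longrightarrow> v \<in> msgs M \<Longrightarrow> ss' \<in> seqs n \<Longrightarrow>
      (\<Sum>xs\<in>seqs n. Z xs w' w ss ys) = (\<Sum>xs\<in>seqs n. Z xs w' v ss' ys)"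
    using conj[THEN conjunct2, THEN conjunct1] assms by blast
  show "i \<in> {1..n-1} \<Longrightarrow> xs \<in> seqs n \<Longrightarrow> w' \<in> msgs M \<Longrightarrow> ss' \<in> seqs n \<Longrightarrow>
      take i ss = take i ss' \<Longrightarrow>
      (\<Sum>xs'\<in>{xs'\<in>seqs n. take i xs' = take i xs}. Z xs' w' w ss ys) =
      (\<Sum>xs'\<in>{xs'\<in>seqs n. take i xs' = take i xs}. Z xs' w' w ss' ys)"
    using conj[THEN conjunct2, THEN conjunct2] assms by blast
qed

lemma ns_scheme_le_1:
  assumes Z: "ns_scheme M n Z" and "w \<in> msgs M" "w' \<in> msgs M" "xs \<in> seqs n" "ss \<in> seqs n" "ys \<in> seqs n"
  shows "Z xs w' w ss ys \<le> 1"
proof -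
  have nonneg: "Z xs w' w ss ys \<ge> 0" if "xs \<in> seqs n" "w' \<in> msgs M" for xs w'
    using assms that by (intro ns_nonneg)
  have "Z xs w' w ss ys \<le> (\<Sum>w'\<in>msgs M. Z xs w' w ss ys)"
    using assms nonneg by (intro member_le_sum) (auto simp: msgs_def)
  also have "\<dots> \<le> (\<Sum>xs\<in>seqs n. \<Sum>w'\<in>msgs M. Z xs w' w ss ys)"
    using assms nonneg by (intro member_le_sum[of _ "seqs n" "\<lambda>xs. \<Sum>w'\<in>msgs M. Z xs w' w ss ys"])
      (auto intro: sum_nonneg)
  also have "\<dots> = 1"
    using assms by (intro ns_sum)
  finally show ?thesis .
qed

text \<open>A real \<open>Sup\<close> dominates its set only if the set is bounded. Entries of
  \<open>Z\<close> lie in [0,1], so setting them to 1 and taking absolute values of the weights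
  gives a bound free of \<open>Z\<close>; \<open>N\<close> and \<open>PS\<close> are arbitrary real
  functions here, so weights may be negative.\<close>

lemma bdd_above_ns_success:
  fixes N :: "'x::finite \<Rightarrow> 's::finite \<Rightarrow> 'y::finite \<Rightarrow> real"
  shows "bdd_above {ns_success N PS M n Z | Z. ns_scheme M n Z}"
proof -
  let ?B = "(1 / real M) * (\<Sum>w\<in>msgs M. \<Sum>xs\<in>seqs n. \<Sum>ss\<in>seqs n. \<Sum>ys\<in>seqs n.
    \<bar>PSn PS ss * Nn N xs ss ys\<bar>)"
  have "ns_success N PS M n Z \<le> ?B"
    if Z: "ns_scheme M n Z" for Z :: "'x list \<Rightarrow> nat \<Rightarrow> nat \<Rightarrow> 's list \<Rightarrow> 'y list \<Rightarrow> real"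
    unfolding ns_success_def
  proof (intro mult_left_mono sum_mono)
    fix w and xs :: "'x list" and ss :: "'s list" and ys :: "'y list"
    assume *: "w \<in> msgs M" "xs \<in> seqs n" "ss \<in> seqs n" "ys \<in> seqs n"
    let ?c = "PSn PS ss * Nn N xs ss ys"
    have "0 \<le> Z xs w w ss ys" "Z xs w w ss ys \<le> 1"
      using ns_nonneg[OF Z, of w ss ys xs w] ns_scheme_le_1[OF Z, of w w xs ss ys] * by auto
    then have "\<bar>?c\<bar> * Z xs w w ss ys \<le> \<bar>?c\<bar> * 1"
      by (intro mult_left_mono) auto
    moreover have "?c * Z xs w w ss ys \<le> \<bar>?c\<bar> * Z xs w w ss ys"
      using \<open>0 \<le> Z xs w w ss ys\<close> by (intro mult_right_mono) auto
    ultimately show "?c * Z xs w w ss ys \<le> \<bar>?c\<bar>" by simp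
  qed auto
  then show ?thesis by (intro bdd_aboveI[of _ ?B]) auto
qed

lemma classical_success_subset_ns_success:
  "{classical_success N PS M n Qs PQ E D | Qs PQ E D. classical_scheme M n Qs PQ E D} \<subseteq>
   {ns_success N PS M n Z | Z. ns_scheme M n Z}"
  by clarify (metis ns_scheme_classical_to_ns ns_success_classical_to_ns)

lemma classical_success_le_eta_C_ca:
  assumes "classical_scheme M n Qs PQ E D"
  shows "classical_success N PS M n Qs PQ E D \<le> eta_C_ca N PS M n"
  unfolding eta_C_ca_def
  using assms bdd_above_mono[OF bdd_above_ns_success classical_success_subset_ns_success]
  by (intro cSup_upper) auto

text \<open>Some classical scheme has to exist because \<open>Sup {}\<close> is unspecified on the reals.\<close>

lemma eta_C_ca_le_eta_NS_ca:
  fixes N :: "'x::finite \<Rightarrow> 's::finite \<Rightarrow> 'y::finite \<Rightarrow> real"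
    and E :: "nat \<Rightarrow> 'x list \<Rightarrow> nat \<Rightarrow> 's list \<Rightarrow> nat \<Rightarrow> 'x \<Rightarrow> real"
    and D :: "'y list \<Rightarrow> nat \<Rightarrow> nat \<Rightarrow> real"
  assumes "classical_scheme M n Qs PQ E D"
  shows "eta_C_ca N PS M n \<le> eta_NS_ca N PS M n"
  unfolding eta_C_ca_def eta_NS_ca_def
  using assms by (intro cSup_subset_mono bdd_above_ns_success classical_success_subset_ns_success) auto

section \<open>Repetition coding with CSIR\<close>

lemma sum_seqs_2: "(\<Sum>xs\<in>seqs 2. f xs) = (\<Sum>a\<in>UNIV. \<Sum>b\<in>UNIV. f [a, b :: 'a::finite])"
proof -
  have "seqs 2 = (\<lambda>(a, b). [a, b :: 'a]) ` UNIV"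
    by (auto simp: seqs_def image_def numeral_2_eq_2 length_Suc_conv)
  moreover have "inj (\<lambda>(a, b). [a, b :: 'a])"
    by (auto simp: inj_on_def)
  ultimately show ?thesis
    by (simp add: sum.reindex sum.cartesian_product case_prod_unfold UNIV_Times_UNIV)
qed

lemma sum_swap_pairs:
  "(\<Sum>a\<in>A. \<Sum>b\<in>B. \<Sum>c\<in>C. \<Sum>d\<in>D. f a b c d) = (\<Sum>c\<in>C. \<Sum>d\<in>D. \<Sum>a\<in>A. \<Sum>b\<in>B. f a b c d)"
  by (simp only: sum.swap[where A = A and B = C] sum.swap[where A = A and B = D]
      sum.swap[where A = B and B = C] sum.swap[where A = B and B = D])

lemma PSn_2: "PSn P [s, t] = P s * P t"
  by (simp add: PSn_def numeral_2_eq_2 lessThan_Suc)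

lemma Nn_2: "Nn N [a, b] [s, t] [y, z] = N a s y * N b t z"
  by (simp add: Nn_def numeral_2_eq_2 lessThan_Suc)

lemma msgs_2: "msgs 2 = {1, 2}"
  by (auto simp: msgs_def)

lemma sum_msgs_2: "(\<Sum>w\<in>msgs 2. f w) = f 1 + f 2"
  by (simp add: msgs_2)

text \<open>\<open>last ss\<close> is the current state, since \<open>ss\<close> holds the states up
  to time \<open>j\<close>. In the variable \<open>u\<close>, message 1 is sent as 0 and message 2
  as 1 in every use.\<close>

definition rep_enc :: "nat \<Rightarrow> bool list \<Rightarrow> nat \<Rightarrow> bool list \<Rightarrow> nat \<Rightarrow> bool \<Rightarrow> real" where
  "rep_enc j xs w ss q x = of_bool (x = (last ss \<noteq> (w = 2)))"

text \<open>\<open>y \<noteq> s\<close> says \<open>v = 1\<close>, which only \<open>u = 1\<close>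
  can produce. So message 1 is never mistaken, and message 2 is missed only if every
  \<open>v\<close> is 0, with probability 1/4 for two uses.\<close>

definition rep_dec :: "(bool \<times> bool) list \<Rightarrow> nat \<Rightarrow> nat \<Rightarrow> real" where
  "rep_dec ys q w = of_bool ((w = 2) = (\<exists>(y, s)\<in>set ys. y \<noteq> s))"

lemma classical_scheme_rep: "classical_scheme 2 n {0} (\<lambda>_. 1) rep_enc rep_dec"
proof -
  have "rep_dec ys q 1 + rep_dec ys q 2 = 1" for ys q
    by (simp add: rep_dec_def)
  then show ?thesis
    by (simp add: classical_scheme_def rep_enc_def msgs_2 UNIV_bool) (auto simp: rep_dec_def)
qed

lemma classical_success_rep:
  "classical_success (csir zchan) zPS 2 2 {0} (\<lambda>_. 1) rep_enc rep_dec = 7/8"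
proof -
  have enc: "enc_prod rep_enc 2 [a, b] w [s, t] 0 =
      of_bool (a = (s \<noteq> (w = 2))) * of_bool (b = (t \<noteq> (w = 2)))" for a b w s t
    by (simp add: enc_prod_def rep_enc_def numeral_2_eq_2)
  have pairs: "(UNIV :: (bool \<times> bool) set) = {False, True} \<times> {False, True}"
    by auto
  show ?thesis
    by (simp add: classical_success_def sum_seqs_2 enc msgs_2 PSn_2 Nn_2 zPS_def csir_def
        zchan_def rep_dec_def UNIV_bool pairs)
qed

section \<open>The upper bound without CSIR\<close>

text \<open>On booleans \<open>\<noteq>\<close> is addition mod 2, so adding \<open>s\<close>
  permutes the range of summation. This is the change of variables from \<open>x\<close> to
  \<open>u\<close> and from \<open>y\<close> to \<open>v\<close>.\<close>

lemma sum_bool_flip: "(\<Sum>a\<in>UNIV. f (a \<noteq> (s :: bool))) = (\<Sum>a\<in>UNIV. f a)"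
  by (cases s) (simp_all add: UNIV_bool add.commute)

lemma sum_bool_flip2:
  "(\<Sum>a\<in>UNIV. \<Sum>b\<in>UNIV. f (a \<noteq> (s :: bool)) (b \<noteq> (t :: bool))) = (\<Sum>a\<in>UNIV. \<Sum>b\<in>UNIV. f a b)"
  unfolding sum_bool_flip[of "f _"] by (rule sum_bool_flip)

lemma zchan_flip: "zchan (a \<noteq> s) s (c \<noteq> s) = zchan a False c"
  by (auto simp: zchan_def)

text \<open>Weak duality. In the application \<open>r a b c d\<close> is the averaged probability of
  \<open>u = (a, b)\<close> and correct decoding when \<open>v = (c, d)\<close>, and
  \<open>p\<close> is the averaged law of \<open>u\<close>. Then \<open>le\<close> reflects (C1),
  \<open>causal\<close> reflects (C3), and \<open>sum\<close> reflects (C2), with 1/2 the chance of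
  guessing one of two messages.\<close>

lemma z_channel_lp_bound:
  fixes r :: "bool \<Rightarrow> bool \<Rightarrow> bool \<Rightarrow> bool \<Rightarrow> real" and p :: "bool \<Rightarrow> bool \<Rightarrow> real"
  assumes nonneg: "\<And>a b c d. 0 \<le> r a b c d"
    and le: "\<And>a b c d. r a b c d \<le> p a b"
    and p: "(\<Sum>a\<in>UNIV. \<Sum>b\<in>UNIV. p a b) = 1"
    and sum: "\<And>c d. (\<Sum>a\<in>UNIV. \<Sum>b\<in>UNIV. r a b c d) = 1/2"
    and causal: "\<And>a c d d'. (\<Sum>b\<in>UNIV. r a b c d) = (\<Sum>b\<in>UNIV. r a b c d')"
  shows "(\<Sum>a\<in>UNIV. \<Sum>b\<in>UNIV. \<Sum>c\<in>UNIV. \<Sum>d\<in>UNIV. zchan a False c * zchan b False d * r a b c d) \<le> 13/16"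
    (is "?obj \<le> _")
proof -
  \<comment> \<open>In state \<open>False\<close>, input 0 is noiseless and input 1 gives a uniform
    output, so nine of the sixteen terms survive.\<close>
  have obj: "?obj = r False False False False + 1/2 * (r False True False False + r False True False True)
    + 1/2 * (r True False False False + r True False True False)
    + 1/4 * (r True True False False + r True True False True + r True True True False + r True True True True)"
    by (simp add: zchan_def UNIV_bool add_divide_distrib)
  \<comment> \<open>The weights are an optimal solution of the dual linear program.\<close>
  have "13/16 - ?obj =
      3/8 * (p False False - r False False False False) + 3/8 * (p False True - r False True False True)
    + 3/8 * (p True False - r True False True False) + 1/8 * (p True True - r True True True False)
    + 1/4 * (p True True - r True True True True)
    + 1/8 * r False False False True + 1/8 * r False False True False + 1/8 * r False True False False
    + 1/8 * r False True True False + 1/4 * r True False False True + 1/4 * r True True False False"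
    \<comment> \<open>The equality constraints enter with multipliers 3/8 for \<open>p\<close>, then
      1/2, 1/4, 1/8 for the three instances of \<open>sum\<close> and 1/8 for \<open>causal\<close>;
      the constant is 3/8 + (1/2 + 1/4 + 1/8)/2 = 13/16.\<close>
    unfolding obj using p sum[of False False] sum[of False True] sum[of True False] causal[of False False False True]
    by (simp add: UNIV_bool field_simps)
  also have "\<dots> \<ge> 0"
    using le nonneg by (intro add_nonneg_nonneg mult_nonneg_nonneg) auto
  finally show ?thesis by simp
qed

lemma ns_success_zchan_le:
  assumes Z: "ns_scheme 2 2 Z"
  shows "ns_success zchan zPS 2 2 Z \<le> 13/16"
proof -
  have seqs: "[a, b] \<in> seqs 2" for a b :: bool
    by (simp add: seqs_def)
  have msgs: "1 \<in> msgs 2" "2 \<in> msgs 2"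
    by (auto simp: msgs_def)
  have prefix: "{xs \<in> seqs 2. take 1 xs = take 1 [a, b]} = {[a, False], [a, True]}" for a b :: bool
    by (auto simp: seqs_def numeral_2_eq_2 length_Suc_conv)
  have nonneg: "Z [a, b] w' w [s, t] [c, d] \<ge> 0" if "w \<in> msgs 2" "w' \<in> msgs 2" for a b w w' s t c d
    using Z that seqs by (intro ns_nonneg)
  have norm: "(\<Sum>a\<in>UNIV. \<Sum>b\<in>UNIV. Z [a, b] 1 w [s, t] [c, d] + Z [a, b] 2 w [s, t] [c, d]) = 1"
    if "w \<in> msgs 2" for w s t c d
  proof -
    have "(\<Sum>xs\<in>seqs 2. \<Sum>w'\<in>msgs 2. Z xs w' w [s, t] [c, d]) = 1"
      using Z that seqs by (intro ns_sum)
    then show ?thesis by (simp add: sum_seqs_2 msgs_2)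
  qed
  have C1: "Z [a, b] 1 w [s, t] [c, d] + Z [a, b] 2 w [s, t] [c, d] =
      Z [a, b] 1 w [s, t] [c', d'] + Z [a, b] 2 w [s, t] [c', d']"
    if "w \<in> msgs 2" for a b w s t c d c' d'
  proof -
    have "(\<Sum>w'\<in>msgs 2. Z [a, b] w' w [s, t] [c, d]) = (\<Sum>w'\<in>msgs 2. Z [a, b] w' w [s, t] [c', d'])"
      using Z that seqs by (intro ns_C1)
    then show ?thesis by (simp add: msgs_2)
  qed
  have C2: "(\<Sum>a\<in>UNIV. \<Sum>b\<in>UNIV. Z [a, b] 2 1 [s, t] [c, d]) = (\<Sum>a\<in>UNIV. \<Sum>b\<in>UNIV. Z [a, b] 2 2 [s, t] [c, d])"
    for s t c d
  proof -
    have "(\<Sum>xs\<in>seqs 2. Z xs 2 1 [s, t] [c, d]) = (\<Sum>xs\<in>seqs 2. Z xs 2 2 [s, t] [c, d])"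
      using Z seqs msgs by (intro ns_C2)
    then show ?thesis by (simp add: sum_seqs_2)
  qed
  have C3: "Z [a, False] w w [s, t] [c, d] + Z [a, True] w w [s, t] [c, d] =
      Z [a, False] w w [s, t'] [c, d] + Z [a, True] w w [s, t'] [c, d]"
    if "w \<in> msgs 2" for a w s t t' c d
  proof -
    have "(\<Sum>xs\<in>{xs \<in> seqs 2. take 1 xs = take 1 [a, False]}. Z xs w w [s, t] [c, d]) =
        (\<Sum>xs\<in>{xs \<in> seqs 2. take 1 xs = take 1 [a, False]}. Z xs w w [s, t'] [c, d])"
      using Z that seqs by (intro ns_C3) auto
    then show ?thesis unfolding prefix by simp
  qed

  define T where "T a b s t c d = Z [a, b] 1 1 [s, t] [c, d] + Z [a, b] 2 2 [s, t] [c, d]" for a b s t c d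
  \<comment> \<open>The factor 1/8 is 1/2 for the uniform message times 1/4 for the uniform state
    pair. The arguments are \<open>u\<close> and \<open>v\<close>, translated back to
    \<open>x\<close> and \<open>y\<close> in each state.\<close>
  define r where "r a b c d = 1/8 * (\<Sum>s\<in>UNIV. \<Sum>t\<in>UNIV. T (a \<noteq> s) (b \<noteq> t) s t (c \<noteq> s) (d \<noteq> t))"
    for a b c d
  \<comment> \<open>The law of the inputs given message and states; by (C1) any output pair could
    stand in place of \<open>[False, False]\<close>.\<close>
  define pw where "pw w a b s t = Z [a, b] 1 w [s, t] [False, False] + Z [a, b] 2 w [s, t] [False, False]"
    for w a b s t
  define p where "p a b = 1/8 * (\<Sum>s\<in>UNIV. \<Sum>t\<in>UNIV. pw 1 (a \<noteq> s) (b \<noteq> t) s t + pw 2 (a \<noteq> s) (b \<noteq> t) s t)"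
    for a b
  have "0 \<le> r a b c d" for a b c d
    unfolding r_def T_def by (intro mult_nonneg_nonneg sum_nonneg add_nonneg_nonneg nonneg msgs) simp
  moreover have "r a b c d \<le> p a b" for a b c d
  proof -
    have "Z [x, y] w w [s, t] [c, d] \<le> pw w x y s t" if "w \<in> msgs 2" for w x y s t c d
    proof -
      have "pw w x y s t = Z [x, y] 1 w [s, t] [c, d] + Z [x, y] 2 w [s, t] [c, d]"
        unfolding pw_def by (rule C1[OF that])
      moreover have "w = 1 \<or> w = 2"
        using that by (simp add: msgs_2)
      ultimately show ?thesis
        using nonneg[OF that msgs(1), of x y s t c d] nonneg[OF that msgs(2), of x y s t c d] by auto
    qed
    from this[OF msgs(1)] this[OF msgs(2)] show ?thesis
      unfolding r_def p_def T_def by (intro mult_left_mono sum_mono add_mono) simp_all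
  qed
  moreover have "(\<Sum>a\<in>UNIV. \<Sum>b\<in>UNIV. p a b) = 1"
  proof -
    have pw: "(\<Sum>a\<in>UNIV. \<Sum>b\<in>UNIV. pw w (a \<noteq> s) (b \<noteq> t) s t) = 1" if "w \<in> msgs 2" for w s t
      using norm[OF that, of s t False False] sum_bool_flip2[of "\<lambda>a b. pw w a b s t" s t] by (simp only: pw_def)
    have "(\<Sum>a\<in>UNIV. \<Sum>b\<in>UNIV. p a b) =
        1/8 * (\<Sum>s\<in>UNIV. \<Sum>t\<in>UNIV. \<Sum>a\<in>UNIV. \<Sum>b\<in>UNIV. pw 1 (a \<noteq> s) (b \<noteq> t) s t + pw 2 (a \<noteq> s) (b \<noteq> t) s t)"
      unfolding p_def sum_distrib_left[symmetric] by (subst sum_swap_pairs) (rule refl)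
    also have "\<dots> = 1/8 * (\<Sum>s\<in>(UNIV :: bool set). \<Sum>t\<in>(UNIV :: bool set). 1 + 1)"
      by (simp only: sum.distrib pw[OF msgs(1)] pw[OF msgs(2)])
    finally show ?thesis by simp
  qed
  moreover have "(\<Sum>a\<in>UNIV. \<Sum>b\<in>UNIV. r a b c d) = 1/2" for c d
  proof -
    \<comment> \<open>(C2) trades message 2 for message 1 under the guess 2. The correct-decoding
      mass of both messages becomes the mass of both guesses for message 1, which is 1.\<close>
    have T: "(\<Sum>a\<in>UNIV. \<Sum>b\<in>UNIV. T (a \<noteq> s) (b \<noteq> t) s t c d) = 1" for s t c d
      using norm[OF msgs(1), of s t c d] C2[of s t c d] sum_bool_flip2[of "\<lambda>a b. T a b s t c d" s t]
      by (simp only: T_def sum.distrib)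
    have "(\<Sum>a\<in>UNIV. \<Sum>b\<in>UNIV. r a b c d) =
        1/8 * (\<Sum>s\<in>UNIV. \<Sum>t\<in>UNIV. \<Sum>a\<in>UNIV. \<Sum>b\<in>UNIV. T (a \<noteq> s) (b \<noteq> t) s t (c \<noteq> s) (d \<noteq> t))"
      unfolding r_def sum_distrib_left[symmetric] by (subst sum_swap_pairs) (rule refl)
    also have "\<dots> = 1/8 * (\<Sum>s\<in>(UNIV :: bool set). \<Sum>t\<in>(UNIV :: bool set). 1)"
      by (simp only: T)
    finally show ?thesis by simp
  qed
  moreover have "(\<Sum>b\<in>UNIV. r a b c d) = (\<Sum>b\<in>UNIV. r a b c d')" for a c d d'
  proof -
    \<comment> \<open>By (C3) the sum over the second input ignores the second state, so
      \<open>t\<close> can be reset to \<open>False\<close> while the outputs stay fixed.\<close>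
    have T: "(\<Sum>b\<in>UNIV. T a b s t c d) = (\<Sum>b\<in>UNIV. T a b s False c d)" for a s t c d
      using C3[OF msgs(1), of a s t c d False] C3[OF msgs(2), of a s t c d False]
      by (simp add: T_def UNIV_bool)
    have flip: "(\<Sum>b\<in>UNIV. T (a \<noteq> s) (b \<noteq> t) s t (c \<noteq> s) (d \<noteq> t)) =
        (\<Sum>b\<in>UNIV. T (a \<noteq> s) b s False (c \<noteq> s) (t \<noteq> d))" for s t d
      using sum_bool_flip[of "\<lambda>b. T (a \<noteq> s) b s t (c \<noteq> s) (d \<noteq> t)" t] T[of "a \<noteq> s" s t "c \<noteq> s" "d \<noteq> t"]
      by (simp only: neq_commute[of t d])
    have "(\<Sum>b\<in>UNIV. r a b c d) = 1/8 * (\<Sum>s\<in>UNIV. \<Sum>t\<in>UNIV. \<Sum>b\<in>UNIV. T (a \<noteq> s) b s False (c \<noteq> s) t)" for d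
    proof -
      have "(\<Sum>b\<in>UNIV. r a b c d) =
          1/8 * (\<Sum>s\<in>UNIV. \<Sum>t\<in>UNIV. \<Sum>b\<in>UNIV. T (a \<noteq> s) (b \<noteq> t) s t (c \<noteq> s) (d \<noteq> t))"
        unfolding r_def sum_distrib_left[symmetric]
        by (subst sum.swap, rule arg_cong, rule sum.cong[OF refl], rule sum.swap)
      also have "\<dots> = 1/8 * (\<Sum>s\<in>UNIV. \<Sum>t\<in>UNIV. \<Sum>b\<in>UNIV. T (a \<noteq> s) b s False (c \<noteq> s) (t \<noteq> d))"
        by (simp only: flip)
      \<comment> \<open>After the reset \<open>t\<close> occurs only in the second output
        \<open>t \<noteq> d\<close>, so summing over \<open>t\<close> removes
        \<open>d\<close>.\<close>
      also have "\<dots> = 1/8 * (\<Sum>s\<in>UNIV. \<Sum>t\<in>UNIV. \<Sum>b\<in>UNIV. T (a \<noteq> s) b s False (c \<noteq> s) t)"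
        by (rule arg_cong, rule sum.cong[OF refl], rule sum_bool_flip)
      finally show ?thesis .
    qed
    then show ?thesis by (simp only:)
  qed
  ultimately have "(\<Sum>a\<in>UNIV. \<Sum>b\<in>UNIV. \<Sum>c\<in>UNIV. \<Sum>d\<in>UNIV. zchan a False c * zchan b False d * r a b c d) \<le> 13/16"
    by (rule z_channel_lp_bound)
  moreover have "ns_success zchan zPS 2 2 Z =
    (\<Sum>a\<in>UNIV. \<Sum>b\<in>UNIV. \<Sum>c\<in>UNIV. \<Sum>d\<in>UNIV. zchan a False c * zchan b False d * r a b c d)"
  proof -
    have "ns_success zchan zPS 2 2 Z = 1/2 *
      (\<Sum>a\<in>UNIV. \<Sum>b\<in>UNIV. \<Sum>s\<in>UNIV. \<Sum>t\<in>UNIV. \<Sum>c\<in>UNIV. \<Sum>d\<in>UNIV.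
        PSn zPS [s, t] * Nn zchan [a, b] [s, t] [c, d] * Z [a, b] 1 1 [s, t] [c, d] +
        PSn zPS [s, t] * Nn zchan [a, b] [s, t] [c, d] * Z [a, b] 2 2 [s, t] [c, d])"
      by (simp only: ns_success_def sum_seqs_2 sum_msgs_2 sum.distrib of_nat_numeral)
    also have "\<dots> =
      (\<Sum>a\<in>UNIV. \<Sum>b\<in>UNIV. \<Sum>s\<in>UNIV. \<Sum>t\<in>UNIV. \<Sum>c\<in>UNIV. \<Sum>d\<in>UNIV.
        1/8 * (zchan a s c * zchan b t d * T a b s t c d))"
      unfolding sum_distrib_left
      by (intro sum.cong refl) (simp add: PSn_2 Nn_2 zPS_def T_def algebra_simps)
    also have "\<dots> = (\<Sum>s\<in>UNIV. \<Sum>t\<in>UNIV. \<Sum>a\<in>UNIV. \<Sum>b\<in>UNIV. \<Sum>c\<in>UNIV. \<Sum>d\<in>UNIV.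
        1/8 * (zchan a s c * zchan b t d * T a b s t c d))"
      by (rule sum_swap_pairs)
    also have "\<dots> = (\<Sum>s\<in>UNIV. \<Sum>t\<in>UNIV. \<Sum>a\<in>UNIV. \<Sum>b\<in>UNIV. \<Sum>c\<in>UNIV. \<Sum>d\<in>UNIV.
        1/8 * (zchan a False c * zchan b False d * T (a \<noteq> s) (b \<noteq> t) s t (c \<noteq> s) (d \<noteq> t)))"
    \<comment> \<open>For each fixed state pair the inputs are shifted first, then the outputs;
      \<open>zchan_flip\<close> then frees the channel factors of the state.\<close>
    proof (rule sum.cong[OF refl], rule sum.cong[OF refl])
      fix s t
      let ?f = "\<lambda>a b c d. 1/8 * (zchan a s c * zchan b t d * T a b s t c d)"
      have "(\<Sum>a\<in>UNIV. \<Sum>b\<in>UNIV. \<Sum>c\<in>UNIV. \<Sum>d\<in>UNIV. ?f a b c d) =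
          (\<Sum>a\<in>UNIV. \<Sum>b\<in>UNIV. \<Sum>c\<in>UNIV. \<Sum>d\<in>UNIV. ?f (a \<noteq> s) (b \<noteq> t) c d)"
        by (rule sum_bool_flip2[symmetric])
      also have "\<dots> = (\<Sum>a\<in>UNIV. \<Sum>b\<in>UNIV. \<Sum>c\<in>UNIV. \<Sum>d\<in>UNIV. ?f (a \<noteq> s) (b \<noteq> t) (c \<noteq> s) (d \<noteq> t))"
        by (rule sum.cong[OF refl], rule sum.cong[OF refl], rule sum_bool_flip2[symmetric])
      finally show "(\<Sum>a\<in>UNIV. \<Sum>b\<in>UNIV. \<Sum>c\<in>UNIV. \<Sum>d\<in>UNIV. ?f a b c d) =
        (\<Sum>a\<in>UNIV. \<Sum>b\<in>UNIV. \<Sum>c\<in>UNIV. \<Sum>d\<in>UNIV.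
          1/8 * (zchan a False c * zchan b False d * T (a \<noteq> s) (b \<noteq> t) s t (c \<noteq> s) (d \<noteq> t)))"
        by (simp only: zchan_flip)
    qed
    also have "\<dots> = (\<Sum>a\<in>UNIV. \<Sum>b\<in>UNIV. \<Sum>s\<in>UNIV. \<Sum>t\<in>UNIV. \<Sum>c\<in>UNIV. \<Sum>d\<in>UNIV.
        1/8 * (zchan a False c * zchan b False d * T (a \<noteq> s) (b \<noteq> t) s t (c \<noteq> s) (d \<noteq> t)))"
      by (rule sum_swap_pairs)
    also have "\<dots> = (\<Sum>a\<in>UNIV. \<Sum>b\<in>UNIV. \<Sum>c\<in>UNIV. \<Sum>d\<in>UNIV. \<Sum>s\<in>UNIV. \<Sum>t\<in>UNIV.
        1/8 * (zchan a False c * zchan b False d * T (a \<noteq> s) (b \<noteq> t) s t (c \<noteq> s) (d \<noteq> t)))"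
      by (rule sum.cong[OF refl], rule sum.cong[OF refl], rule sum_swap_pairs)
    also have "\<dots> = (\<Sum>a\<in>UNIV. \<Sum>b\<in>UNIV. \<Sum>c\<in>UNIV. \<Sum>d\<in>UNIV. zchan a False c * zchan b False d * r a b c d)"
      unfolding r_def sum_distrib_left by (intro sum.cong refl) simp
    finally show ?thesis .
  qed
  ultimately show ?thesis by simp
qed

section \<open>The three inequalities combined\<close>

theorem theorem2:
  shows "eta_NS_ca (csir zchan) zPS 2 2 \<ge> eta_C_ca (csir zchan) zPS 2 2
       \<and> eta_C_ca (csir zchan) zPS 2 2 \<ge> 7/8
       \<and> eta_NS_ca zchan zPS 2 2 \<le> 13/16"
proof (intro conjI)
  show "eta_C_ca (csir zchan) zPS 2 2 \<le> eta_NS_ca (csir zchan) zPS 2 2"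
    by (rule eta_C_ca_le_eta_NS_ca[OF classical_scheme_rep])
  show "7/8 \<le> eta_C_ca (csir zchan) zPS 2 2"
    using classical_success_le_eta_C_ca[OF classical_scheme_rep, of "csir zchan" zPS 2]
    by (simp add: classical_success_rep)
  \<comment> \<open>\<open>cSup_least\<close> asks for a nonempty set. The witness comes from the
    classical scheme whose decoder always answers 1.\<close>
  have "\<exists>Z :: bool list \<Rightarrow> nat \<Rightarrow> nat \<Rightarrow> bool list \<Rightarrow> bool list \<Rightarrow> real. ns_scheme 2 2 Z"
  proof
    have "classical_scheme 2 2 {0} (\<lambda>_. 1) rep_enc (\<lambda>(_ :: bool list) _ w. of_bool (w = 1))"
      by (auto simp: classical_scheme_def rep_enc_def msgs_2 UNIV_bool)
    then show "ns_scheme 2 2 (classical_to_ns 2 {0} (\<lambda>_. 1) rep_enc (\<lambda>(_ :: bool list) _ w. of_bool (w = 1)))"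
      by (rule ns_scheme_classical_to_ns)
  qed
  then show "eta_NS_ca zchan zPS 2 2 \<le> 13/16"
    unfolding eta_NS_ca_def by (intro cSup_least) (blast intro: ns_success_zchan_le)+
qed

end
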